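(* Let $d_n\colon \bigoplus_{i=1}^{t}\Gamma\mathbf{e}'_i\to\bigoplus_{j=1}^{s}\Gamma\mathbf{e}_j$ be a degree-preserving $\Gamma$-homomorphism between finitely generated free graded left $\Gamma$-modules. Let $\mathbf{f}_1,\dots,\mathbf{f}_t\in\bigoplus_{j=1}^{s}R\mathbf{e}_j$ be homogeneous vectors with $|\mathbf{f}_i|=|\mathbf{e}'_i|$ such that $\mathbf{f}_i$ and $d_n(\mathbf{e}'_i)$ have the same image in $\bigoplus_{j=1}^{s}(R/\langle\Omega(k-|\mathbf{e}_j|)\rangle)\mathbf{e}_j$ for each $i$, and suppose that $\{\mathbf{f}_1,\dots,\mathbf{f}_t\}$ is an $(\Omega,k)$-minimal generating set (of the submodule it $(\Omega,k)$-generates). Let $\{\mathbf{h}_1,\dots,\mathbf{h}_r\}\subset\bigoplus_{i=1}^{t}R\mathbf{e}'_i$ be an $(\Omega,k)$-minimal generating set, consisting of homogeneous vectors, of the $(\Omega,k)$-syzygy module $\mathrm{Syz}_{\Omega,k}(\mathbf{f}_1,\dots,\mathbf{f}_t)$. Let $\bigoplus_{i=1}^{r}\Gamma\mathbf{e}''_i$ be the free graded left $\Gamma$-module with $|\mathbf{e}''_i|=|\mathbf{h}_i|$, and define $d_{n+1}(\mathbf{e}''_i)=\bar{\mathbf{h}}_i$, where $\bar{\mathbf{h}}_i$ is the image of $\mathbf{h}_i$ in $\bigoplus_{i=1}^{t}\Gamma\mathbf{e}'_i$. Then the sequence $$\bigoplus_{i=1}^{r}\Gamma\mathbf{e}''_i\xrightarrow{d_{n+1}}\bigoplus_{i=1}^{t}\Gamma\mathbf{e}'_i\xrightarrow{d_n}\bigoplus_{j=1}^{s}\Gamma\mathbf{e}_j$$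 is exact (at the middle term) in degrees less than or equal to $k$, and $$d_{n+1}\Big(\bigoplus_{i=1}^{r}\Gamma\mathbf{e}''_i\Big)\subset I(\Gamma)\cdot\Big(\bigoplus_{i=1}^{t}\Gamma\mathbf{e}'_i\Big).$$
   Context: $K$ is a field and $R=K\langle x_1,x_2,\dots\rangle$ is a free noncommutative graded $K$-algebra with $|x_i|=a_i>0$. A monomial ordering on $R$ is a well-ordering on the monomials (words) such that $X<Y$ implies $UXV<UYV$ for monomials $U,V$, and $X=UYV$ with $U\ne1$ or $V\neq 1$ implies $Y<X$; one is fixed. $\Omega\subset R$ is a set of nonzero homogeneous polynomials that is a Gröbner basis of the two-sided ideal $\langle\Omega\rangle$ (the leading monomial of each nonzero element of $\langle\Omega\rangle$ contains as a subword the leading monomial of some element of $\Omega$). $k$ is a positive integer. $\Gamma=R/\langle\Omega\rangle$ is a graded algebra with augmentation $\eta\colon\Gamma\to K$ (induced by $x_i\mapsto0$), and $I(\Gamma)=\ker\eta$. For an integer $l$, $\Omega(l)=\Omega\cup\{g\in R: g \text{ homogeneous},\ |g|>l\}$, and $\langle\Omega(l)\rangle$ is the two-sided ideal it generates. All modules are left modules; free modules $\bigoplus_i R\mathbf{e}_i$ are graded by assigning degrees $|\mathbf{e}_i|$ to basis elements. A submodule $M\subset\bigoplus_{i=1}^mR\mathbf{e}_i$ is $(\Omega,k)$-generated by a set $F$, written $M=\langle F\rangle_{\Omega,k}$, if $M=\{\sum_j p_j\mathbf{f}_j+\sum_{i=1}^m q_i\mathbf{e}_i : p_j\in R,\ \mathbf{f}_j\in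 F,\ q_i\in\langle\Omega(k-|\mathbf{e}_i|)\rangle\}$ (finite sums). A set $\{\mathbf{f}_1,\dots,\mathbf{f}_r\}$ is an $(\Omega,k)$-minimal generating set of $M$ if $M=\langle\mathbf{f}_1,\dots,\mathbf{f}_r\rangle_{\Omega,k}$ and $\mathbf{f}_j\notin\langle\mathbf{f}_1,\dots,\mathbf{f}_{j-1},\mathbf{f}_{j+1},\dots,\mathbf{f}_r\rangle_{\Omega,k}$ for every $j$. For homogeneous vectors $\mathbf{f}_1,\dots,\mathbf{f}_t\in\bigoplus_{j=1}^sR\mathbf{e}_j$, let $\varphi\colon\bigoplus_{i=1}^tR\mathbf{e}'_i\to\bigoplus_{j=1}^sR\mathbf{e}_j$, $|\mathbf{e}'_i|=|\mathbf{f}_i|$, be the degree-preserving $R$-homomorphism with $\varphi(\mathbf{e}'_i)=\mathbf{f}_i$. Then $\mathrm{Syz}_{\Omega,k}(\mathbf{f}_1,\dots,\mathbf{f}_t)=\varphi^{-1}\big(\bigoplus_{j=1}^s\langle\Omega(k-|\mathbf{e}_j|)\rangle\mathbf{e}_j\big)$. *)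

theory Defs
  imports
    "HOL-Library.Poly_Mapping"
    "HOL-Library.Countable"
    "HOL-Algebra.Module"
    "HOL-Algebra.Algebraic_Closure_Type"
begin

section \<open>The free noncommutative graded algebra\<close>

text \<open>Monomials are words. The monoid of words is written additively because the convolution
  product of \<^theory>\<open>HOL-Library.Poly_Mapping\<close> is based on \<^class>\<open>monoid_add\<close>: \<open>0\<close> is the empty
  word and \<open>+\<close> is (noncommutative) concatenation. With it, the library type
  \<open>'v mon \<Rightarrow>\<^sub>0 'k\<close> is the free algebra on the variables \<open>'v\<close> over the field \<open>'k\<close>.\<close>

datatype 'v mon = Mon (letters: "'v list")

instantiation mon :: (type) monoid_add
begin

definition zero_mon :: "'a mon" where "0 = Mon []"

definition plus_mon :: "'a mon \<Rightarrow> 'a mon \<Rightarrow> 'a mon" where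
  "u + v = Mon (letters u @ letters v)"

instance by standard (auto simp: zero_mon_def plus_mon_def)

end

type_synonym ('v, 'k) falg = "'v mon \<Rightarrow>\<^sub>0 'k"

text \<open>The same ring as a record, so that the ideals and quotients of HOL-Algebra apply.\<close>

abbreviation FA :: "('v, 'k::field) falg ring" where
  "FA \<equiv> ring_of_type_algebra"

lemma ring_FA: "ring (FA :: ('v, 'k::field) falg ring)"
proof -
  have "\<exists>y. x + y = 0" for x :: "('v, 'k) falg"
    using add.right_inverse by blast
  then show ?thesis
    unfolding ring_of_type_algebra_def using add.right_inverse
    by unfold_locales (auto simp: algebra_simps Units_def)
qed

definition mon_degree :: "('v \<Rightarrow> nat) \<Rightarrow> 'v mon \<Rightarrow> nat" where
  "mon_degree a w = sum_list (map a (letters w))"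

text \<open>Degrees are integers, since \<open>k - |e\<^sub>j|\<close> may be negative.\<close>

definition homog :: "('v \<Rightarrow> nat) \<Rightarrow> int \<Rightarrow> ('v, 'k::field) falg set" where
  "homog a q = {p. \<forall>w \<in> Poly_Mapping.keys p. int (mon_degree a w) = q}"

text \<open>The \<open>K\<close>-algebra homomorphism with \<open>x\<^sub>i \<mapsto> c\<^sub>i\<close>, and the augmentation \<open>x\<^sub>i \<mapsto> 0\<close>.\<close>

definition alg_eval :: "('v \<Rightarrow> 'k) \<Rightarrow> ('v, 'k::field) falg \<Rightarrow> 'k" where
  "alg_eval c p =
    (\<Sum>w \<in> Poly_Mapping.keys p. Poly_Mapping.lookup p w * prod_list (map c (letters w)))"

definition augm :: "('v, 'k::field) falg \<Rightarrow> 'k" where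
  "augm = alg_eval (\<lambda>_. 0)"


section \<open>Monomial orderings and Groebner bases\<close>

text \<open>\<open>(x, y) \<in> ord\<close> stands for \<open>x \<le> y\<close>.\<close>

definition monomial_ordering :: "('v mon \<times> 'v mon) set \<Rightarrow> bool" where
  "monomial_ordering ord \<longleftrightarrow>
     well_order_on UNIV ord \<and>
     (\<forall>x y u v. (x, y) \<in> ord - Id \<longrightarrow> (u + x + v, u + y + v) \<in> ord - Id) \<and>
     (\<forall>x y u v. x = u + y + v \<and> (u \<noteq> 0 \<or> v \<noteq> 0) \<longrightarrow> (y, x) \<in> ord - Id)"

definition lead_mon :: "('v mon \<times> 'v mon) set \<Rightarrow> ('v, 'k::field) falg \<Rightarrow> 'v mon" where
  "lead_mon ord p =
     (THE w. w \<in> Poly_Mapping.keys p \<and> (\<forall>u \<in> Poly_Mapping.keys p. (u, w) \<in> ord))"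

definition groebner_basis ::
    "('v mon \<times> 'v mon) set \<Rightarrow> ('v, 'k::field) falg set \<Rightarrow> bool" where
  "groebner_basis ord \<Omega> \<longleftrightarrow>
     (\<forall>g \<in> Idl\<^bsub>FA\<^esub> \<Omega>. g \<noteq> 0 \<longrightarrow>
        (\<exists>\<omega> \<in> \<Omega>. \<exists>u v. lead_mon ord g = u + lead_mon ord \<omega> + v))"


section \<open>The quotient algebra\<close>

definition Gam :: "('v, 'k::field) falg set \<Rightarrow> ('v, 'k) falg set ring" where
  "Gam \<Omega> = FA Quot (Idl\<^bsub>FA\<^esub> \<Omega>)"

definition Gam_proj :: "('v, 'k::field) falg set \<Rightarrow> ('v, 'k) falg \<Rightarrow> ('v, 'k) falg set" where
  "Gam_proj \<Omega> p = (Idl\<^bsub>FA\<^esub> \<Omega>) +>\<^bsub>FA\<^esub> p"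

definition Gam_homog ::
    "('v \<Rightarrow> nat) \<Rightarrow> ('v, 'k::field) falg set \<Rightarrow> int \<Rightarrow> ('v, 'k) falg set set" where
  "Gam_homog a \<Omega> q = Gam_proj \<Omega> ` homog a q"

text \<open>The map induced by \<^const>\<open>augm\<close> on cosets; it is well defined when \<^const>\<open>augm\<close> vanishes
  on \<open>\<Omega>\<close>.\<close>

definition Gam_augm :: "('v, 'k::field) falg set \<Rightarrow> 'k" where
  "Gam_augm C = the_elem (augm ` C)"

definition aug_ideal :: "('v, 'k::field) falg set \<Rightarrow> ('v, 'k) falg set set" where
  "aug_ideal \<Omega> = {C \<in> carrier (Gam \<Omega>). Gam_augm C = 0}"

definition Omega_trunc ::
    "('v \<Rightarrow> nat) \<Rightarrow> ('v, 'k::field) falg set \<Rightarrow> int \<Rightarrow> ('v, 'k) falg set" where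
  "Omega_trunc a \<Omega> l = \<Omega> \<union> {g. \<exists>q > l. g \<in> homog a q}"

abbreviation trunc_ideal ::
    "('v \<Rightarrow> nat) \<Rightarrow> ('v, 'k::field) falg set \<Rightarrow> int \<Rightarrow> ('v, 'k) falg set" where
  "trunc_ideal a \<Omega> l \<equiv> Idl\<^bsub>FA\<^esub> (Omega_trunc a \<Omega> l)"


section \<open>Free graded left modules\<close>

text \<open>The free left module on \<open>e\<^sub>0, \<dots>, e\<^sub>n\<^sub>-\<^sub>1\<close> over a (noncommutative) ring \<open>A\<close>. The
  library's record type is used, but not its module locale, which requires a commutative ring. Vectors are their coordinate functions, extensional on
  \<open>{..<n}\<close>. The ring multiplication and unit of the record are irrelevant.\<close>

definition free_mod :: "('a, 'b) ring_scheme \<Rightarrow> nat \<Rightarrow> ('a, nat \<Rightarrow> 'a) module" where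
  "free_mod A n =
    \<lparr>carrier = {..<n} \<rightarrow>\<^sub>E carrier A,
     monoid.mult = undefined, one = undefined,
     zero = (\<lambda>i\<in>{..<n}. \<zero>\<^bsub>A\<^esub>),
     add = (\<lambda>x y. \<lambda>i\<in>{..<n}. x i \<oplus>\<^bsub>A\<^esub> y i),
     module.smult = (\<lambda>c x. \<lambda>i\<in>{..<n}. c \<otimes>\<^bsub>A\<^esub> x i)\<rparr>"

definition basis_vec :: "('a, 'b) ring_scheme \<Rightarrow> nat \<Rightarrow> nat \<Rightarrow> nat \<Rightarrow> 'a" where
  "basis_vec A n i = (\<lambda>j\<in>{..<n}. if j = i then \<one>\<^bsub>A\<^esub> else \<zero>\<^bsub>A\<^esub>)"

text \<open>Homogeneous vectors of degree \<open>q\<close>, where \<open>G\<close> is the grading of the ring and \<open>b i\<close> is the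
  degree of \<open>e\<^sub>i\<close>.\<close>

definition free_homog :: "(int \<Rightarrow> 'a set) \<Rightarrow> nat \<Rightarrow> (nat \<Rightarrow> int) \<Rightarrow> int \<Rightarrow> (nat \<Rightarrow> 'a) set" where
  "free_homog G n b q = (\<Pi>\<^sub>E i\<in>{..<n}. G (q - b i))"

definition left_module_hom ::
    "('a, 'b) ring_scheme \<Rightarrow> ('a, 'm, 'c) module_scheme \<Rightarrow> ('a, 'n, 'd) module_scheme
      \<Rightarrow> ('m \<Rightarrow> 'n) set" where
  "left_module_hom A M N =
    {d \<in> carrier M \<rightarrow> carrier N.
       (\<forall>x \<in> carrier M. \<forall>y \<in> carrier M. d (x \<oplus>\<^bsub>M\<^esub> y) = d x \<oplus>\<^bsub>N\<^esub> d y) \<and>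
       (\<forall>c \<in> carrier A. \<forall>x \<in> carrier M. d (c \<odot>\<^bsub>M\<^esub> x) = c \<odot>\<^bsub>N\<^esub> d x)}"

text \<open>The homomorphism from the free module of rank \<open>n\<close> to \<open>M\<close> that sends the \<open>i\<close>-th basis
  vector to \<open>v i\<close>.\<close>

definition free_map ::
    "('a, 'm, 'c) module_scheme \<Rightarrow> nat \<Rightarrow> (nat \<Rightarrow> 'm) \<Rightarrow> (nat \<Rightarrow> 'a) \<Rightarrow> 'm" where
  "free_map M n v x = (\<Oplus>\<^bsub>M\<^esub> i\<in>{..<n}. x i \<odot>\<^bsub>M\<^esub> v i)"

text \<open>All finite sums of products \<open>c \<odot> x\<close> with \<open>c \<in> C\<close> and \<open>x \<in> S\<close>. For \<open>C = carrier A\<close> this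
  is the submodule generated by \<open>S\<close>; for an ideal \<open>C\<close> and \<open>S = carrier M\<close> it is \<open>C \<cdot> M\<close>.\<close>

definition lin_combs :: "('a, 'm, 'c) module_scheme \<Rightarrow> 'a set \<Rightarrow> 'm set \<Rightarrow> 'm set" where
  "lin_combs M C S =
    {(\<Oplus>\<^bsub>M\<^esub> j\<in>{..<n}. c j \<odot>\<^bsub>M\<^esub> x j) | (n::nat) c x.
       c \<in> {..<n} \<rightarrow> C \<and> x \<in> {..<n} \<rightarrow> S}"


section \<open>Truncated generation and syzygies\<close>

text \<open>In this section \<open>b i\<close> is the degree of the \<open>i\<close>-th basis vector of the ambient free module
  of rank \<open>m\<close>.\<close>

definition trunc_zero ::
    "('v \<Rightarrow> nat) \<Rightarrow> ('v, 'k::field) falg set \<Rightarrow> int \<Rightarrow> nat \<Rightarrow> (nat \<Rightarrow> int)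
      \<Rightarrow> (nat \<Rightarrow> ('v, 'k) falg) set" where
  "trunc_zero a \<Omega> k m b = (\<Pi>\<^sub>E i\<in>{..<m}. trunc_ideal a \<Omega> (k - b i))"

definition trunc_gen ::
    "('v \<Rightarrow> nat) \<Rightarrow> ('v, 'k::field) falg set \<Rightarrow> int \<Rightarrow> nat \<Rightarrow> (nat \<Rightarrow> int)
      \<Rightarrow> (nat \<Rightarrow> ('v, 'k) falg) set \<Rightarrow> (nat \<Rightarrow> ('v, 'k) falg) set" where
  "trunc_gen a \<Omega> k m b F =
    {u \<oplus>\<^bsub>free_mod FA m\<^esub> z | u z.
       u \<in> lin_combs (free_mod FA m) (carrier FA) F \<and> z \<in> trunc_zero a \<Omega> k m b}"

definition trunc_min_gen ::
    "('v \<Rightarrow> nat) \<Rightarrow> ('v, 'k::field) falg set \<Rightarrow> int \<Rightarrow> nat \<Rightarrow> (nat \<Rightarrow> int)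
      \<Rightarrow> nat \<Rightarrow> (nat \<Rightarrow> nat \<Rightarrow> ('v, 'k) falg) \<Rightarrow> (nat \<Rightarrow> ('v, 'k) falg) set \<Rightarrow> bool" where
  "trunc_min_gen a \<Omega> k m b r f M \<longleftrightarrow>
     f \<in> {..<r} \<rightarrow> carrier (free_mod FA m) \<and>
     M = trunc_gen a \<Omega> k m b (f ` {..<r}) \<and>
     (\<forall>j<r. f j \<notin> trunc_gen a \<Omega> k m b (f ` ({..<r} - {j})))"

definition trunc_syz ::
    "('v \<Rightarrow> nat) \<Rightarrow> ('v, 'k::field) falg set \<Rightarrow> int \<Rightarrow> nat \<Rightarrow> (nat \<Rightarrow> int)
      \<Rightarrow> nat \<Rightarrow> (nat \<Rightarrow> nat \<Rightarrow> ('v, 'k) falg) \<Rightarrow> (nat \<Rightarrow> ('v, 'k) falg) set" where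
  "trunc_syz a \<Omega> k m b t f =
    {p \<in> carrier (free_mod FA t). free_map (free_mod FA m) t f p \<in> trunc_zero a \<Omega> k m b}"

end

theory Submission
  imports Defs
begin

text \<open>
  Write \<open>I\<close> for the ideal generated by \<open>\<Omega>\<close> and \<open>I(l)\<close> for the one generated by \<open>\<Omega>\<close> together
  with everything homogeneous of degree above \<open>l\<close>. Since the grading is nonnegative and \<open>\<Omega>\<close> is
  homogeneous, a polynomial lies in \<open>I(l)\<close> iff its components of degree at most \<open>l\<close> lie in \<open>I\<close>
  (\<open>trunc_ideal_iff\<close>). Truncation therefore changes nothing in degrees at most \<open>k\<close>, and the proof
  consists in translating the computation of truncated syzygies into the quotient algebra.

  Exactness. Choose a homogeneous matrix \<open>g\<close> over the free algebra that represents \<open>d\<close>. A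
  homogeneous vector \<open>p\<close> of degree \<open>q \<le> k\<close> represents an element of the kernel of \<open>d\<close> iff
  \<open>\<Sum>i. p i * g i j\<close> lies in \<open>I\<close> for all \<open>j\<close>. Replacing \<open>g\<close> by \<open>f\<close> changes this sum only within
  \<open>I\<close>, and in the degree at hand \<open>I\<close> may be replaced by the truncated ideal; so the condition is
  that \<open>p\<close> is a truncated syzygy of \<open>f\<close> (\<open>homog_ker_iff_trunc_syz\<close>). The truncated syzygies are the
  combinations of the \<open>h i\<close> up to truncated ideals, and the component of degree \<open>q\<close> of such a
  representation is an honest homogeneous representation modulo \<open>I\<close> (\<open>homog_trunc_gen_coeffs\<close>).

  Minimality. If an entry of some \<open>h i\<close> had a nonzero constant term, by homogeneity and positivity
  of the degrees it would be a nonzero scalar, and the syzygy \<open>h i\<close> would express one of the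
  \<open>f l\<close> by the others up to the truncated ideals (\<open>syz_of_minimal_augm\<close>). So all entries lie
  in the augmentation ideal.
\<close>

section \<open>The free algebra as a record, its ideals and cosets\<close>

lemma FA_simps [simp]:
  "carrier (FA :: ('v, 'k::field) falg ring) = UNIV"
  "x \<oplus>\<^bsub>FA\<^esub> y = x + y" "x \<otimes>\<^bsub>FA\<^esub> y = x * y"
  "\<zero>\<^bsub>FA\<^esub> = 0" "\<one>\<^bsub>FA\<^esub> = 1"
  for x y :: "('v, 'k::field) falg"
  by (simp_all add: ring_of_type_algebra_def)

lemma ideal_FA_iff:
  fixes J :: "('v, 'k::field) falg set"
  shows "ideal J FA \<longleftrightarrow> 0 \<in> J \<and> (\<forall>x\<in>J. \<forall>y\<in>J. x + y \<in> J) \<and>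
     (\<forall>c. \<forall>x\<in>J. c * x \<in> J \<and> x * c \<in> J)" (is "_ \<longleftrightarrow> ?R")
proof
  assume "ideal J FA"
  then interpret ideal J FA .
  show ?R
    using additive_subgroup.zero_closed[OF additive_subgroup_axioms]
      additive_subgroup.a_closed[OF additive_subgroup_axioms] I_l_closed I_r_closed by auto
next
  assume R: ?R
  interpret FA: ring "FA :: ('v, 'k) falg ring" by (rule ring_FA)
  show "ideal J FA"
  proof (rule idealI[OF ring_FA])
    show "subgroup J (add_monoid FA)"
    proof (rule FA.add.subgroupI)
      fix x assume "x \<in> J"
      then have "(- 1) * x \<in> J" using R by blast
      moreover have "\<ominus>\<^bsub>FA\<^esub> x = - x"
        by (rule FA.minus_equality) simp_all
      ultimately show "\<ominus>\<^bsub>FA\<^esub> x \<in> J" by simp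
    qed (use R in auto)
  qed (use R in auto)
qed

lemma ideal_Idl: "ideal (Idl\<^bsub>FA\<^esub> S) (FA :: ('v, 'k::field) falg ring)"
  by (rule ring.genideal_ideal[OF ring_FA]) simp

lemma subset_Idl: "S \<subseteq> Idl\<^bsub>FA\<^esub> (S :: ('v, 'k::field) falg set)"
  by (rule ring.genideal_self[OF ring_FA]) simp

lemmas Idl_minimal = ring.genideal_minimal[OF ring_FA]

lemma ideal_0: "ideal J FA \<Longrightarrow> (0 :: ('v, 'k::field) falg) \<in> J"
  and ideal_add: "ideal J FA \<Longrightarrow> x \<in> J \<Longrightarrow> y \<in> J \<Longrightarrow> x + y \<in> J"
  and ideal_lmult: "ideal J FA \<Longrightarrow> x \<in> J \<Longrightarrow> c * x \<in> J"
  and ideal_rmult: "ideal J FA \<Longrightarrow> x \<in> J \<Longrightarrow> x * c \<in> J"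
  for x y c :: "('v, 'k::field) falg"
  by (auto simp: ideal_FA_iff)

lemma ideal_minus: "ideal J FA \<Longrightarrow> x \<in> J \<Longrightarrow> - x \<in> J"
  for x :: "('v, 'k::field) falg"
  using ideal_lmult[of J x "- 1"] by simp

lemma ideal_diff: "ideal J FA \<Longrightarrow> x \<in> J \<Longrightarrow> y \<in> J \<Longrightarrow> x - y \<in> J"
  for x y :: "('v, 'k::field) falg"
  using ideal_add[of J x "- y"] ideal_minus[of J y] by simp

lemma ideal_sum: "ideal J FA \<Longrightarrow> (\<And>i. i \<in> S \<Longrightarrow> x i \<in> J) \<Longrightarrow> (\<Sum>i\<in>S. x i) \<in> J"
  for x :: "'b \<Rightarrow> ('v, 'k::field) falg"
  by (induction S rule: infinite_finite_induct) (auto simp: ideal_0 ideal_add)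

lemma coset_FA: "J +>\<^bsub>FA\<^esub> p = (\<lambda>x. x + p) ` J"
  for p :: "('v, 'k::field) falg"
  by (auto simp: a_r_coset_def r_coset_def)

lemma set_add_FA: "A <+>\<^bsub>FA\<^esub> B = {x + y | x y. x \<in> A \<and> y \<in> B}"
  for A :: "('v, 'k::field) falg set"
  by (auto simp: set_add_def set_mult_def)

lemma coset_eq_iff:
  fixes p q :: "('v, 'k::field) falg"
  assumes J: "ideal J FA"
  shows "J +>\<^bsub>FA\<^esub> p = J +>\<^bsub>FA\<^esub> q \<longleftrightarrow> p - q \<in> J"
proof
  assume "J +>\<^bsub>FA\<^esub> p = J +>\<^bsub>FA\<^esub> q"
  moreover have "p \<in> J +>\<^bsub>FA\<^esub> p"
    using ideal_0[OF J] by (force simp: coset_FA)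
  ultimately show "p - q \<in> J" by (auto simp: coset_FA)
next
  assume pq: "p - q \<in> J"
  have "x + p \<in> (\<lambda>x. x + q) ` J" if "x \<in> J" for x
    by (rule image_eqI[of _ _ "x + (p - q)"]) (use that pq ideal_add[OF J] in auto)
  moreover have "x + q \<in> (\<lambda>x. x + p) ` J" if "x \<in> J" for x
    by (rule image_eqI[of _ _ "x - (p - q)"]) (use that pq ideal_diff[OF J] in auto)
  ultimately show "J +>\<^bsub>FA\<^esub> p = J +>\<^bsub>FA\<^esub> q" by (auto simp: coset_FA)
qed

lemma Gam_proj_eq_iff: "Gam_proj \<Omega> p = Gam_proj \<Omega> q \<longleftrightarrow> p - q \<in> Idl\<^bsub>FA\<^esub> \<Omega>"
  by (simp add: Gam_proj_def coset_eq_iff ideal_Idl)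

text \<open>The hypothesis on the lifts adds an ideal \<open>J\<close> to a whole coset of a smaller ideal; this turns
  that set sum into an ordinary coset, so that the hypothesis becomes a membership of a difference
  in \<open>J\<close>.\<close>

lemma set_add_Gam_proj:
  assumes J: "ideal J FA" and sub: "Idl\<^bsub>FA\<^esub> \<Omega> \<subseteq> J"
  shows "J <+>\<^bsub>FA\<^esub> Gam_proj \<Omega> p = J +>\<^bsub>FA\<^esub> p"
proof
  have "x + (y + p) \<in> (\<lambda>x. x + p) ` J" if "x \<in> J" "y \<in> Idl\<^bsub>FA\<^esub> \<Omega>" for x y
    by (rule image_eqI[of _ _ "x + y"]) (use that sub ideal_add[OF J] in \<open>auto simp: add.assoc\<close>)
  then show "J <+>\<^bsub>FA\<^esub> Gam_proj \<Omega> p \<subseteq> J +>\<^bsub>FA\<^esub> p"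
    by (auto simp: Gam_proj_def coset_FA set_add_FA)
  have "\<exists>u y. x + p = u + y \<and> u \<in> J \<and> y \<in> (\<lambda>x. x + p) ` (Idl\<^bsub>FA\<^esub> \<Omega>)" if "x \<in> J" for x
    using that ideal_0[OF ideal_Idl[of \<Omega>]] by (intro exI[of _ x] exI[of _ p]) force
  then show "J +>\<^bsub>FA\<^esub> p \<subseteq> J <+>\<^bsub>FA\<^esub> Gam_proj \<Omega> p"
    by (auto simp: Gam_proj_def coset_FA set_add_FA)
qed

lemma ring_Gam: "ring (Gam \<Omega>)"
  unfolding Gam_def by (rule ideal.quotient_is_ring[OF ideal_Idl])

lemma Gam_proj_ring_hom: "ring_hom_ring FA (Gam \<Omega>) (Gam_proj \<Omega>)"
proof -
  have "Gam_proj \<Omega> = (+>\<^bsub>FA\<^esub>) (Idl\<^bsub>FA\<^esub> \<Omega>)" by (simp add: fun_eq_iff Gam_proj_def)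
  then show ?thesis unfolding Gam_def using ideal.rcos_ring_hom_ring[OF ideal_Idl] by metis
qed

lemma carrier_Gam: "carrier (Gam \<Omega>) = range (Gam_proj \<Omega>)"
  by (auto simp: Gam_def FactRing_def A_RCOSETS_def RCOSETS_def Gam_proj_def a_r_coset_def)

lemma Gam_ops:
  "Gam_proj \<Omega> p \<oplus>\<^bsub>Gam \<Omega>\<^esub> Gam_proj \<Omega> q = Gam_proj \<Omega> (p + q)"
  "Gam_proj \<Omega> p \<otimes>\<^bsub>Gam \<Omega>\<^esub> Gam_proj \<Omega> q = Gam_proj \<Omega> (p * q)"
  "\<zero>\<^bsub>Gam \<Omega>\<^esub> = Gam_proj \<Omega> 0" "\<one>\<^bsub>Gam \<Omega>\<^esub> = Gam_proj \<Omega> 1"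
proof -
  interpret ring_hom_ring FA "Gam \<Omega>" "Gam_proj \<Omega>" by (rule Gam_proj_ring_hom)
  show "Gam_proj \<Omega> p \<oplus>\<^bsub>Gam \<Omega>\<^esub> Gam_proj \<Omega> q = Gam_proj \<Omega> (p + q)"
    "Gam_proj \<Omega> p \<otimes>\<^bsub>Gam \<Omega>\<^esub> Gam_proj \<Omega> q = Gam_proj \<Omega> (p * q)"
    "\<zero>\<^bsub>Gam \<Omega>\<^esub> = Gam_proj \<Omega> 0" "\<one>\<^bsub>Gam \<Omega>\<^esub> = Gam_proj \<Omega> 1"
    using hom_add[of p q] hom_mult[of p q] hom_zero hom_one by simp_all
qed

lemma finsum_FA: "finsum FA g S = (\<Sum>i\<in>S. g i)"
  for g :: "'b \<Rightarrow> ('v, 'k::field) falg"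
proof -
  interpret ring "FA :: ('v, 'k) falg ring" by (rule ring_FA)
  show ?thesis by (induction S rule: infinite_finite_induct) auto
qed

lemma finsum_Gam: "finsum (Gam \<Omega>) (\<lambda>i. Gam_proj \<Omega> (g i)) S = Gam_proj \<Omega> (\<Sum>i\<in>S. g i)"
  using ring_hom_ring.hom_finsum[OF Gam_proj_ring_hom, of g S \<Omega>] by (simp add: finsum_FA o_def)


section \<open>Homogeneous components\<close>

definition hcomp :: "('v \<Rightarrow> nat) \<Rightarrow> int \<Rightarrow> ('v, 'k::field) falg \<Rightarrow> ('v, 'k) falg" where
  "hcomp a q p = Abs_poly_mapping
     (\<lambda>w. if int (mon_degree a w) = q then Poly_Mapping.lookup p w else 0)"

definition support_degrees :: "('v \<Rightarrow> nat) \<Rightarrow> ('v, 'k::field) falg \<Rightarrow> int set" where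
  "support_degrees a p = (\<lambda>w. int (mon_degree a w)) ` Poly_Mapping.keys p"

lemma lookup_hcomp: "Poly_Mapping.lookup (hcomp a q p) w =
    (if int (mon_degree a w) = q then Poly_Mapping.lookup p w else 0)"
proof -
  have "finite {w. (if int (mon_degree a w) = q then Poly_Mapping.lookup p w else 0) \<noteq> 0}"
    by (rule finite_subset[OF _ finite_keys[of p]]) (auto simp: in_keys_iff split: if_splits)
  then show ?thesis by (simp add: hcomp_def)
qed

lemma homog_iff: "p \<in> homog a q \<longleftrightarrow>
    (\<forall>w. Poly_Mapping.lookup p w \<noteq> 0 \<longrightarrow> int (mon_degree a w) = q)"
  by (auto simp: homog_def in_keys_iff)

lemma hcomp_add: "hcomp a q (x + y) = hcomp a q x + hcomp a q y"
  by (rule poly_mapping_eqI) (simp add: lookup_hcomp lookup_add)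

lemma hcomp_0 [simp]: "hcomp a q 0 = 0"
  by (rule poly_mapping_eqI) (simp add: lookup_hcomp)

lemma hcomp_sum: "hcomp a q (\<Sum>i\<in>S. g i) = (\<Sum>i\<in>S. hcomp a q (g i))"
  by (induction S rule: infinite_finite_induct) (auto simp: hcomp_add)

lemma hcomp_homog: "hcomp a q p \<in> homog a q"
  by (auto simp: homog_iff lookup_hcomp)

lemma hcomp_of_homog: "p \<in> homog a m \<Longrightarrow> hcomp a q p = (if m = q then p else 0)"
  by (rule poly_mapping_eqI) (auto simp: lookup_hcomp homog_iff)

lemma finite_support_degrees: "finite (support_degrees a p)" by (simp add: support_degrees_def)

lemma support_degrees_nonneg: "e \<in> support_degrees a p \<Longrightarrow> 0 \<le> e" by (auto simp: support_degrees_def)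

lemma hcomp_outside_support: "q \<notin> support_degrees a p \<Longrightarrow> hcomp a q p = 0"
  by (rule poly_mapping_eqI) (auto simp: lookup_hcomp support_degrees_def in_keys_iff)

lemma sum_hcomp: "(\<Sum>e\<in>support_degrees a p. hcomp a e p) = p"
proof (rule poly_mapping_eqI)
  fix w
  show "Poly_Mapping.lookup (\<Sum>e\<in>support_degrees a p. hcomp a e p) w = Poly_Mapping.lookup p w"
    by (auto simp: lookup_sum lookup_hcomp sum.delta' finite_support_degrees support_degrees_def in_keys_iff)
qed

lemma mon_degree_add: "mon_degree a (u + v) = mon_degree a u + mon_degree a v"
  by (simp add: mon_degree_def plus_mon_def)

lemma homog_mult: "x \<in> homog a m \<Longrightarrow> y \<in> homog a n \<Longrightarrow> x * y \<in> homog a (m + n)"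
  using keys_mult[of x y] by (fastforce simp: homog_def mon_degree_add)

lemma homog_0 [simp]: "0 \<in> homog a q" by (simp add: homog_def)

lemma homog_1: "1 \<in> homog a 0"
  by (simp add: homog_def mon_degree_def zero_mon_def)

lemma homog_add: "x \<in> homog a q \<Longrightarrow> y \<in> homog a q \<Longrightarrow> x + y \<in> homog a q"
  using keys_add[of x y] by (auto simp: homog_def)

lemma homog_minus: "x \<in> homog a q \<Longrightarrow> - x \<in> homog a q"
  by (simp add: homog_def)

lemma homog_diff: "x \<in> homog a q \<Longrightarrow> y \<in> homog a q \<Longrightarrow> x - y \<in> homog a q"
  using homog_add[of x a q "- y"] homog_minus[of y a q] by simp

lemma homog_sum: "(\<And>i. i \<in> S \<Longrightarrow> x i \<in> homog a q) \<Longrightarrow> (\<Sum>i\<in>S. x i) \<in> homog a q"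
  by (induction S rule: infinite_finite_induct) (auto simp: homog_add)

lemma homog_negative: "p \<in> homog a q \<Longrightarrow> q < 0 \<Longrightarrow> p = 0"
  by (rule poly_mapping_eqI) (auto simp: homog_iff)

lemma hcomp_mult_left:
  "hcomp a q (c * p) = (\<Sum>e\<in>support_degrees a c. hcomp a e c * hcomp a (q - e) p)"
proof -
  have "hcomp a q (c * p) =
      hcomp a q ((\<Sum>e\<in>support_degrees a c. hcomp a e c) * (\<Sum>m\<in>support_degrees a p. hcomp a m p))"
    by (simp add: sum_hcomp)
  also have "\<dots> = (\<Sum>e\<in>support_degrees a c. \<Sum>m\<in>support_degrees a p. hcomp a q (hcomp a e c * hcomp a m p))"
    by (simp add: sum_product hcomp_sum)
  also have "\<dots> = (\<Sum>e\<in>support_degrees a c. hcomp a e c * hcomp a (q - e) p)"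
  proof (rule sum.cong[OF refl])
    fix e
    have "(\<Sum>m\<in>support_degrees a p. hcomp a q (hcomp a e c * hcomp a m p)) =
        (\<Sum>m\<in>support_degrees a p. if m = q - e then hcomp a e c * hcomp a m p else 0)"
      by (intro sum.cong refl) (auto simp: hcomp_of_homog[OF homog_mult[OF hcomp_homog hcomp_homog]])
    also have "\<dots> = hcomp a e c * hcomp a (q - e) p"
      by (auto simp: finite_support_degrees hcomp_outside_support)
    finally show "(\<Sum>m\<in>support_degrees a p. hcomp a q (hcomp a e c * hcomp a m p)) =
        hcomp a e c * hcomp a (q - e) p" .
  qed
  finally show ?thesis .
qed

lemma hcomp_mult_right:
  "hcomp a q (p * c) = (\<Sum>e\<in>support_degrees a c. hcomp a (q - e) p * hcomp a e c)"
proof -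
  have "hcomp a q (p * c) =
      hcomp a q ((\<Sum>m\<in>support_degrees a p. hcomp a m p) * (\<Sum>e\<in>support_degrees a c. hcomp a e c))"
    by (simp add: sum_hcomp)
  also have "\<dots> = (\<Sum>e\<in>support_degrees a c. \<Sum>m\<in>support_degrees a p. hcomp a q (hcomp a m p * hcomp a e c))"
    by (simp add: sum_product hcomp_sum) (rule sum.swap)
  also have "\<dots> = (\<Sum>e\<in>support_degrees a c. hcomp a (q - e) p * hcomp a e c)"
  proof (rule sum.cong[OF refl])
    fix e
    have "(\<Sum>m\<in>support_degrees a p. hcomp a q (hcomp a m p * hcomp a e c)) =
        (\<Sum>m\<in>support_degrees a p. if m = q - e then hcomp a m p * hcomp a e c else 0)"
      by (intro sum.cong refl) (auto simp: hcomp_of_homog[OF homog_mult[OF hcomp_homog hcomp_homog]])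
    also have "\<dots> = hcomp a (q - e) p * hcomp a e c"
      by (auto simp: finite_support_degrees hcomp_outside_support)
    finally show "(\<Sum>m\<in>support_degrees a p. hcomp a q (hcomp a m p * hcomp a e c)) =
        hcomp a (q - e) p * hcomp a e c" .
  qed
  finally show ?thesis .
qed

text \<open>Because \<open>y\<close> sits in one degree, only one component of \<open>c\<close> contributes. This is what
  lets the coefficients of a relation be made homogeneous.\<close>

lemma hcomp_mult_homog:
  assumes "y \<in> homog a m"
  shows "hcomp a q (c * y) = hcomp a (q - m) c * y"
proof -
  have "hcomp a q (c * y) = (\<Sum>e\<in>support_degrees a c. if e = q - m then hcomp a e c * y else 0)"
    unfolding hcomp_mult_left by (intro sum.cong refl) (auto simp: hcomp_of_homog[OF assms])
  also have "\<dots> = hcomp a (q - m) c * y"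
    by (auto simp: finite_support_degrees hcomp_outside_support)
  finally show ?thesis .
qed


section \<open>Truncated ideals\<close>

text \<open>All variables have nonnegative degree, so a component of a product uses only components of
  the factors of the same or lower degree. Hence the condition on low components is stable under
  multiplication from both sides. It is used with \<open>P\<close> always true, and with \<open>P q\<close> meaning
  \<open>q \<le> l\<close>.\<close>

lemma ideal_low_components:
  assumes J: "ideal J FA" and down: "\<And>q q'. P q \<Longrightarrow> q' \<le> q \<Longrightarrow> P q'"
  shows "ideal {p :: ('v, 'k::field) falg. \<forall>q. P q \<longrightarrow> hcomp a q p \<in> J} FA"
proof -
  have low: "hcomp a (q - e) x \<in> J"
    if "e \<in> support_degrees a c" "\<forall>q. P q \<longrightarrow> hcomp a q x \<in> J" "P q" for c x :: "('v, 'k) falg" and q e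
    using that down[of q "q - e"] support_degrees_nonneg[OF that(1)] by simp
  have "hcomp a q (c * x) \<in> J" "hcomp a q (x * c) \<in> J"
    if "\<forall>q. P q \<longrightarrow> hcomp a q x \<in> J" "P q" for c x :: "('v, 'k) falg" and q
    unfolding hcomp_mult_left[of a q c x] hcomp_mult_right[of a q x c]
    by (intro ideal_sum[OF J] ideal_lmult[OF J] ideal_rmult[OF J] low[OF _ that]; assumption)+
  then show ?thesis
    unfolding ideal_FA_iff
    by (auto simp: hcomp_add intro: ideal_0[OF J] ideal_add[OF J])
qed

lemma hcomp_Idl:
  assumes \<Omega>: "\<And>g. g \<in> \<Omega> \<Longrightarrow> \<exists>q. g \<in> homog a q" and p: "p \<in> Idl\<^bsub>FA\<^esub> \<Omega>"
  shows "hcomp a q p \<in> Idl\<^bsub>FA\<^esub> \<Omega>"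
proof -
  have "\<Omega> \<subseteq> {p. \<forall>q. True \<longrightarrow> hcomp a q p \<in> Idl\<^bsub>FA\<^esub> \<Omega>}"
    using \<Omega> subset_Idl[of \<Omega>] ideal_0[OF ideal_Idl[of \<Omega>]] by (fastforce simp: hcomp_of_homog)
  from Idl_minimal[OF ideal_low_components[OF ideal_Idl] this] p show ?thesis by auto
qed

lemma Idl_subset_trunc_ideal: "Idl\<^bsub>FA\<^esub> \<Omega> \<subseteq> trunc_ideal a \<Omega> l"
  by (rule Idl_minimal[OF ideal_Idl]) (use subset_Idl[of "Omega_trunc a \<Omega> l"] in \<open>auto simp: Omega_trunc_def\<close>)

text \<open>The truncated ideal contains everything above degree \<open>l\<close> and, since low components of a
  product only see low components of its factors, nothing new below. So it agrees with
  the ideal generated by \<open>\<Omega>\<close> in degrees up to \<open>l\<close>.\<close>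

lemma trunc_ideal_iff:
  assumes \<Omega>: "\<And>g. g \<in> \<Omega> \<Longrightarrow> \<exists>q. g \<in> homog a q"
  shows "p \<in> trunc_ideal a \<Omega> l \<longleftrightarrow> (\<forall>q\<le>l. hcomp a q p \<in> Idl\<^bsub>FA\<^esub> \<Omega>)"
proof
  let ?J = "{p. \<forall>q. q \<le> l \<longrightarrow> hcomp a q p \<in> Idl\<^bsub>FA\<^esub> \<Omega>}"
  have "Omega_trunc a \<Omega> l \<subseteq> ?J"
    using \<Omega> hcomp_Idl[OF \<Omega>] subset_Idl[of \<Omega>] ideal_0[OF ideal_Idl[of \<Omega>]]
    by (auto simp: Omega_trunc_def hcomp_of_homog)
  then have "trunc_ideal a \<Omega> l \<subseteq> ?J"
    by (rule Idl_minimal[rotated]) (rule ideal_low_components[OF ideal_Idl], simp)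
  moreover assume "p \<in> trunc_ideal a \<Omega> l"
  ultimately show "\<forall>q\<le>l. hcomp a q p \<in> Idl\<^bsub>FA\<^esub> \<Omega>" by blast
next
  assume low: "\<forall>q\<le>l. hcomp a q p \<in> Idl\<^bsub>FA\<^esub> \<Omega>"
  have "hcomp a q p \<in> trunc_ideal a \<Omega> l" for q
  proof (cases "q \<le> l")
    case True
    then show ?thesis using low Idl_subset_trunc_ideal[of \<Omega> a l] by blast
  next
    case False
    then have "hcomp a q p \<in> Omega_trunc a \<Omega> l"
      using hcomp_homog[of a q p] by (auto simp: Omega_trunc_def)
    then show ?thesis using subset_Idl by blast
  qed
  then have "(\<Sum>e\<in>support_degrees a p. hcomp a e p) \<in> trunc_ideal a \<Omega> l"
    by (intro ideal_sum ideal_Idl)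
  then show "p \<in> trunc_ideal a \<Omega> l" by (simp add: sum_hcomp)
qed

lemma homog_trunc_ideal_iff:
  assumes \<Omega>: "\<And>g. g \<in> \<Omega> \<Longrightarrow> \<exists>q. g \<in> homog a q" and p: "p \<in> homog a q" and "q \<le> l"
  shows "p \<in> trunc_ideal a \<Omega> l \<longleftrightarrow> p \<in> Idl\<^bsub>FA\<^esub> \<Omega>"
proof
  assume "p \<in> trunc_ideal a \<Omega> l"
  then have "hcomp a q p \<in> Idl\<^bsub>FA\<^esub> \<Omega>" using trunc_ideal_iff[OF \<Omega>] \<open>q \<le> l\<close> by blast
  then show "p \<in> Idl\<^bsub>FA\<^esub> \<Omega>" by (simp add: hcomp_of_homog[OF p])
qed (use Idl_subset_trunc_ideal in blast)


section \<open>Free modules coordinate by coordinate\<close>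

lemma free_mod_simps [simp]:
  "carrier (free_mod A n) = ({..<n} \<rightarrow>\<^sub>E carrier A)"
  "\<zero>\<^bsub>free_mod A n\<^esub> = (\<lambda>i\<in>{..<n}. \<zero>\<^bsub>A\<^esub>)"
  "x \<oplus>\<^bsub>free_mod A n\<^esub> y = (\<lambda>i\<in>{..<n}. x i \<oplus>\<^bsub>A\<^esub> y i)"
  "c \<odot>\<^bsub>free_mod A n\<^esub> x = (\<lambda>i\<in>{..<n}. c \<otimes>\<^bsub>A\<^esub> x i)"
  by (simp_all add: free_mod_def)

lemma finsum_free_mod:
  assumes "ring A" and v: "\<And>i. i \<in> S \<Longrightarrow> v i \<in> carrier (free_mod A n)"
  shows "finsum (free_mod A n) v S = (\<lambda>l\<in>{..<n}. finsum A (\<lambda>i. v i l) S)"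
proof -
  interpret A: ring A by fact
  interpret M: abelian_monoid "free_mod A n"
    by (rule abelian_monoidI)
      (auto simp: PiE_iff A.a_ac intro!: extensionalityI[of _ "{..<n}"] restrict_ext)
  show ?thesis
    using v
  proof (induction S rule: infinite_finite_induct)
    case (insert i S)
    then have "(\<lambda>i. v i l) \<in> S \<rightarrow> carrier A" "v i l \<in> carrier A" if "l < n" for l
      using that by (auto simp: PiE_iff)
    moreover have "finsum (free_mod A n) v (insert i S) =
        v i \<oplus>\<^bsub>free_mod A n\<^esub> finsum (free_mod A n) v S"
      using insert by (intro M.finsum_insert) (auto simp del: free_mod_simps)
    ultimately show ?case using insert by (auto simp del: M.finsum_insert intro!: restrict_ext)
  qed simp_all
qed

text \<open>The canonical surjection from the free module over the free algebra to the one over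
  \<open>\<Gamma>\<close>. Writing every vector over \<open>\<Gamma>\<close> as such an image replaces computations in the quotient by
  computations with representatives.\<close>

definition vec_proj :: "('v, 'k::field) falg set \<Rightarrow> nat \<Rightarrow> (nat \<Rightarrow> ('v, 'k) falg)
    \<Rightarrow> nat \<Rightarrow> ('v, 'k) falg set" where
  "vec_proj \<Omega> n p = (\<lambda>i\<in>{..<n}. Gam_proj \<Omega> (p i))"

lemma vec_proj_eq_iff:
  "vec_proj \<Omega> n p = vec_proj \<Omega> n q \<longleftrightarrow> (\<forall>i<n. p i - q i \<in> Idl\<^bsub>FA\<^esub> \<Omega>)"
  by (auto simp: vec_proj_def Gam_proj_eq_iff[symmetric] fun_eq_iff restrict_def)

lemma vec_proj_cong: "(\<And>i. i < n \<Longrightarrow> p i = q i) \<Longrightarrow> vec_proj \<Omega> n p = vec_proj \<Omega> n q"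
  by (simp add: vec_proj_def restrict_def fun_eq_iff)

lemma PiE_image_eq: "(\<Pi>\<^sub>E i\<in>S. g ` B i) = (\<lambda>p. \<lambda>i\<in>S. g (p i)) ` (\<Pi>\<^sub>E i\<in>S. B i)"
proof (rule equalityI; rule subsetI)
  fix x assume x: "x \<in> (\<Pi>\<^sub>E i\<in>S. g ` B i)"
  then have "\<forall>i\<in>S. \<exists>y\<in>B i. x i = g y" by (auto simp: PiE_iff)
  then obtain p where p: "\<And>i. i \<in> S \<Longrightarrow> p i \<in> B i \<and> x i = g (p i)" by metis
  then have "restrict p S \<in> (\<Pi>\<^sub>E i\<in>S. B i)" "x = (\<lambda>i\<in>S. g (restrict p S i))"
    using x by (auto simp: PiE_iff fun_eq_iff extensional_def)
  then show "x \<in> (\<lambda>p. \<lambda>i\<in>S. g (p i)) ` (\<Pi>\<^sub>E i\<in>S. B i)" by blast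
qed auto

lemma carrier_free_mod_Gam: "carrier (free_mod (Gam \<Omega>) n) = range (vec_proj \<Omega> n)"
proof -
  have "vec_proj \<Omega> n p \<in> vec_proj \<Omega> n ` ({..<n} \<rightarrow>\<^sub>E UNIV)" for p
    by (rule image_eqI[of _ _ "restrict p {..<n}"]) (auto intro: vec_proj_cong)
  moreover have "carrier (free_mod (Gam \<Omega>) n) = vec_proj \<Omega> n ` ({..<n} \<rightarrow>\<^sub>E UNIV)"
    by (simp add: carrier_Gam PiE_image_eq vec_proj_def)
  ultimately show ?thesis by blast
qed

lemma free_homog_Gam: "free_homog (Gam_homog a \<Omega>) n b q = vec_proj \<Omega> n ` free_homog (homog a) n b q"
  by (simp add: free_homog_def Gam_homog_def PiE_image_eq vec_proj_def)

lemma vec_proj_add: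
  "vec_proj \<Omega> n p \<oplus>\<^bsub>free_mod (Gam \<Omega>) n\<^esub> vec_proj \<Omega> n q = vec_proj \<Omega> n (\<lambda>i. p i + q i)"
  by (auto simp: vec_proj_def Gam_ops intro!: restrict_ext)

lemma vec_proj_smult:
  "Gam_proj \<Omega> c \<odot>\<^bsub>free_mod (Gam \<Omega>) n\<^esub> vec_proj \<Omega> n p = vec_proj \<Omega> n (\<lambda>i. c * p i)"
  by (auto simp: vec_proj_def Gam_ops intro!: restrict_ext)

lemma vec_proj_zero: "\<zero>\<^bsub>free_mod (Gam \<Omega>) n\<^esub> = vec_proj \<Omega> n (\<lambda>_. 0)"
  by (simp add: vec_proj_def Gam_ops)

lemma basis_vec_Gam: "basis_vec (Gam \<Omega>) n i = vec_proj \<Omega> n (\<lambda>j. if j = i then 1 else 0)"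
  by (auto simp: basis_vec_def vec_proj_def Gam_ops intro!: restrict_ext)

lemma finsum_vec_proj:
  assumes u: "\<And>i. i \<in> S \<Longrightarrow> u i = vec_proj \<Omega> n (p i)"
  shows "finsum (free_mod (Gam \<Omega>) n) u S = vec_proj \<Omega> n (\<lambda>l. \<Sum>i\<in>S. p i l)"
proof -
  have "u i \<in> carrier (free_mod (Gam \<Omega>) n)" if "i \<in> S" for i
    unfolding u[OF that] carrier_free_mod_Gam by simp
  then have "finsum (free_mod (Gam \<Omega>) n) u S = (\<lambda>l\<in>{..<n}. finsum (Gam \<Omega>) (\<lambda>i. u i l) S)"
    by (rule finsum_free_mod[OF ring_Gam])
  also have "\<dots> = (\<lambda>l\<in>{..<n}. finsum (Gam \<Omega>) (\<lambda>i. Gam_proj \<Omega> (p i l)) S)"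
    by (intro restrict_ext
        abelian_monoid.finsum_cong'[OF ring.axioms(1)[OF ring_Gam, THEN abelian_group.axioms(1)]])
      (auto simp: u vec_proj_def carrier_Gam)
  also have "\<dots> = vec_proj \<Omega> n (\<lambda>l. \<Sum>i\<in>S. p i l)"
    by (simp only: finsum_Gam vec_proj_def)
  finally show ?thesis .
qed

lemma free_map_Gam:
  "free_map (free_mod (Gam \<Omega>) n) r (\<lambda>i. vec_proj \<Omega> n (v i)) (vec_proj \<Omega> r c) =
   vec_proj \<Omega> n (\<lambda>l. \<Sum>i<r. c i * v i l)"
  unfolding free_map_def
  by (rule finsum_vec_proj) (simp del: free_mod_simps add: vec_proj_smult[symmetric], simp add: vec_proj_def)

lemma finsum_free_mod_FA:
  fixes c :: "'b \<Rightarrow> ('v, 'k::field) falg"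
  shows "finsum (free_mod FA m) (\<lambda>i. c i \<odot>\<^bsub>free_mod FA m\<^esub> x i) S = (\<lambda>l\<in>{..<m}. \<Sum>i\<in>S. c i * x i l)"
  by (subst finsum_free_mod[OF ring_FA]) (auto simp: finsum_FA intro!: restrict_ext)

lemma free_map_FA:
  fixes f :: "nat \<Rightarrow> nat \<Rightarrow> ('v, 'k::field) falg"
  shows "free_map (free_mod FA m) t f p = (\<lambda>l\<in>{..<m}. \<Sum>i<t. p i * f i l)"
  unfolding free_map_def by (rule finsum_free_mod_FA)

text \<open>Combinations with repeated generators collapse to one coefficient per index. As \<open>h\<close>
  may repeat a vector, an index is chosen for each occurrence before collecting.\<close>

lemma lin_combs_FA:
  fixes h :: "nat \<Rightarrow> nat \<Rightarrow> ('v, 'k::field) falg"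
  assumes S: "finite S"
  shows "lin_combs (free_mod FA m) (carrier FA) (h ` S) =
    range (\<lambda>c. \<lambda>l\<in>{..<m}. \<Sum>i\<in>S. c i * h i l)"
proof (rule equalityI; rule subsetI)
  fix u assume "u \<in> lin_combs (free_mod FA m) (carrier FA) (h ` S)"
  then obtain n :: nat and c x where u: "u = (\<lambda>l\<in>{..<m}. \<Sum>j<n. c j * x j l)"
    and x: "x \<in> {..<n} \<rightarrow> h ` S"
    unfolding lin_combs_def finsum_free_mod_FA by auto
  have "\<forall>j\<in>{..<n}. \<exists>i\<in>S. x j = h i" using x by auto
  then obtain \<sigma> where \<sigma>: "\<And>j. j < n \<Longrightarrow> \<sigma> j \<in> S \<and> x j = h (\<sigma> j)" by (metis lessThan_iff)
  \<comment> \<open>collects the coefficients of all positions that use the index \<open>i\<close>\<close>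
  define C where "C i = (\<Sum>j<n. if \<sigma> j = i then c j else 0)" for i
  have "(\<Sum>i\<in>S. C i * h i l) = (\<Sum>j<n. c j * x j l)" for l
  proof -
    have "(\<Sum>i\<in>S. C i * h i l) = (\<Sum>j<n. \<Sum>i\<in>S. (if \<sigma> j = i then c j else 0) * h i l)"
      unfolding C_def sum_distrib_right by (rule sum.swap)
    also have "\<dots> = (\<Sum>j<n. c j * x j l)"
    proof (rule sum.cong[OF refl])
      fix j assume "j \<in> {..<n}"
      then have "\<sigma> j \<in> S" "x j = h (\<sigma> j)" using \<sigma> by auto
      have "(\<Sum>i\<in>S. (if \<sigma> j = i then c j else 0) * h i l) =
          (\<Sum>i\<in>S. if \<sigma> j = i then c j * h i l else 0)"
        by (rule sum.cong) auto
      also have "\<dots> = c j * x j l" using \<open>\<sigma> j \<in> S\<close> \<open>x j = h (\<sigma> j)\<close> S by simp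
      finally show "(\<Sum>i\<in>S. (if \<sigma> j = i then c j else 0) * h i l) = c j * x j l" .
    qed
    finally show ?thesis .
  qed
  then show "u \<in> range (\<lambda>c. \<lambda>l\<in>{..<m}. \<Sum>i\<in>S. c i * h i l)"
    using u by (intro image_eqI[of _ _ C]) auto
next
  fix u assume "u \<in> range (\<lambda>c. \<lambda>l\<in>{..<m}. \<Sum>i\<in>S. c i * h i l)"
  then obtain c where u: "u = (\<lambda>l\<in>{..<m}. \<Sum>i\<in>S. c i * h i l)" by auto
  obtain \<sigma> where \<sigma>: "bij_betw \<sigma> {..<card S} S"
    using ex_bij_betw_nat_finite[OF S] by (auto simp: atLeast0LessThan)
  have "u = (\<lambda>l\<in>{..<m}. \<Sum>j<card S. c (\<sigma> j) * h (\<sigma> j) l)"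
    unfolding u by (intro restrict_ext sum.reindex_bij_betw[OF \<sigma>, symmetric])
  moreover have "\<sigma> j \<in> S" if "j < card S" for j using bij_betwE[OF \<sigma>] that by auto
  ultimately show "u \<in> lin_combs (free_mod FA m) (carrier FA) (h ` S)"
    unfolding lin_combs_def finsum_free_mod_FA
    by (intro CollectI exI[of _ "card S"] exI[of _ "\<lambda>j. c (\<sigma> j)"] exI[of _ "\<lambda>j. h (\<sigma> j)"]) auto
qed

lemma trunc_gen_iff:
  fixes h :: "nat \<Rightarrow> nat \<Rightarrow> ('v, 'k::field) falg"
  assumes S: "finite S"
  shows "u \<in> trunc_gen a \<Omega> k m b (h ` S) \<longleftrightarrow> u \<in> extensional {..<m} \<and>
    (\<exists>c. \<forall>l<m. u l - (\<Sum>i\<in>S. c i * h i l) \<in> trunc_ideal a \<Omega> (k - b l))"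
proof
  assume "u \<in> trunc_gen a \<Omega> k m b (h ` S)"
  then obtain c z where "u = (\<lambda>l\<in>{..<m}. \<Sum>i\<in>S. c i * h i l) \<oplus>\<^bsub>free_mod FA m\<^esub> z"
    and z: "z \<in> trunc_zero a \<Omega> k m b"
    unfolding trunc_gen_def lin_combs_FA[OF S] by blast
  then have "u = (\<lambda>l\<in>{..<m}. (\<Sum>i\<in>S. c i * h i l) + z l)" by (auto simp: fun_eq_iff)
  with z show "u \<in> extensional {..<m} \<and>
      (\<exists>c. \<forall>l<m. u l - (\<Sum>i\<in>S. c i * h i l) \<in> trunc_ideal a \<Omega> (k - b l))"
    by (auto simp: trunc_zero_def PiE_iff intro!: exI[of _ c])
next
  assume "u \<in> extensional {..<m} \<and>
      (\<exists>c. \<forall>l<m. u l - (\<Sum>i\<in>S. c i * h i l) \<in> trunc_ideal a \<Omega> (k - b l))"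
  then obtain c where u: "u \<in> extensional {..<m}"
    and c: "\<And>l. l < m \<Longrightarrow> u l - (\<Sum>i\<in>S. c i * h i l) \<in> trunc_ideal a \<Omega> (k - b l)" by blast
  let ?v = "\<lambda>l\<in>{..<m}. \<Sum>i\<in>S. c i * h i l" and ?z = "\<lambda>l\<in>{..<m}. u l - (\<Sum>i\<in>S. c i * h i l)"
  have "u = ?v \<oplus>\<^bsub>free_mod FA m\<^esub> ?z"
    using u by (auto simp: fun_eq_iff extensional_def)
  moreover have "?z \<in> trunc_zero a \<Omega> k m b" using c by (auto simp: trunc_zero_def)
  moreover have "?v \<in> lin_combs (free_mod FA m) (carrier FA) (h ` S)"
    unfolding lin_combs_FA[OF S] by blast
  ultimately show "u \<in> trunc_gen a \<Omega> k m b (h ` S)" unfolding trunc_gen_def by blast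
qed

lemma trunc_syz_iff:
  fixes f :: "nat \<Rightarrow> nat \<Rightarrow> ('v, 'k::field) falg"
  shows "p \<in> trunc_syz a \<Omega> k m b t f \<longleftrightarrow> p \<in> extensional {..<t} \<and>
    (\<forall>l<m. (\<Sum>i<t. p i * f i l) \<in> trunc_ideal a \<Omega> (k - b l))"
  by (auto simp: trunc_syz_def free_map_FA trunc_zero_def PiE_iff)

text \<open>Linearity is applied to the truncations of \<open>p\<close> to its first \<open>n\<close> coordinates, adding one
  coordinate at a time.\<close>

lemma left_module_hom_vec_proj:
  assumes d: "d \<in> left_module_hom (Gam \<Omega>) (free_mod (Gam \<Omega>) t) (free_mod (Gam \<Omega>) s)"
    and g: "\<And>i. i < t \<Longrightarrow> d (basis_vec (Gam \<Omega>) t i) = vec_proj \<Omega> s (g i)"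
  shows "d (vec_proj \<Omega> t p) = vec_proj \<Omega> s (\<lambda>j. \<Sum>i<t. p i * g i j)"
proof -
  let ?M = "free_mod (Gam \<Omega>) t" and ?N = "free_mod (Gam \<Omega>) s"
  have in_M: "vec_proj \<Omega> t x \<in> carrier ?M" for x unfolding carrier_free_mod_Gam by simp
  have add: "d (vec_proj \<Omega> t (\<lambda>i. x i + y i)) = d (vec_proj \<Omega> t x) \<oplus>\<^bsub>?N\<^esub> d (vec_proj \<Omega> t y)"
    for x y using d in_M unfolding vec_proj_add[symmetric] left_module_hom_def by blast
  have smult: "d (vec_proj \<Omega> t (\<lambda>i. c * x i)) = Gam_proj \<Omega> c \<odot>\<^bsub>?N\<^esub> d (vec_proj \<Omega> t x)"
    for c x using d in_M carrier_Gam unfolding vec_proj_smult[symmetric] left_module_hom_def by blast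
  have "d (vec_proj \<Omega> t (\<lambda>i. if i < n then p i else 0)) = vec_proj \<Omega> s (\<lambda>j. \<Sum>i<n. p i * g i j)"
    if "n \<le> t" for n
    using that
  proof (induction n)
    case 0
    have "d (vec_proj \<Omega> t (\<lambda>_. 0)) \<in> carrier ?N"
      using d in_M unfolding left_module_hom_def by blast
    then obtain y where "d (vec_proj \<Omega> t (\<lambda>_. 0)) = vec_proj \<Omega> s y"
      unfolding carrier_free_mod_Gam by blast
    then show ?case using smult[of 0 "\<lambda>_. 0"] by (simp add: vec_proj_smult del: free_mod_simps)
  next
    case (Suc n)
    have "(\<lambda>i. if i < Suc n then p i else 0) =
        (\<lambda>i. (if i < n then p i else 0) + p n * (if i = n then 1 else 0))"
      by (auto simp: fun_eq_iff less_Suc_eq)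
    moreover have "d (vec_proj \<Omega> t (\<lambda>i. p n * (if i = n then 1 else 0))) =
        vec_proj \<Omega> s (\<lambda>j. p n * g n j)"
      using Suc.prems by (simp add: smult g[unfolded basis_vec_Gam] vec_proj_smult del: free_mod_simps)
    ultimately show ?case
      using Suc by (simp add: add vec_proj_add del: free_mod_simps)
  qed
  from this[of t] show ?thesis
    using vec_proj_cong[of t p "\<lambda>i. if i < t then p i else 0"] by simp
qed


section \<open>The augmentation\<close>

lemma augm_eq_lookup: "augm p = Poly_Mapping.lookup p 0"
proof -
  have 1: "prod_list (map (\<lambda>_. 0) (letters w)) = (if w = 0 then 1 else (0 :: 'k::field))" for w :: "'v mon"
    by (cases w; cases "letters w") (auto simp: zero_mon_def)
  show ?thesis
    unfolding augm_def alg_eval_def 1 by (auto simp: in_keys_iff if_distrib cong: if_cong)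
qed

lemma mon_add_eq_0_iff: "u + v = 0 \<longleftrightarrow> u = 0 \<and> v = 0" for u v :: "'v mon"
  by (cases u; cases v) (auto simp: plus_mon_def zero_mon_def)

text \<open>The empty word is a product only of empty words, so it occurs in a product only if it
  occurs in both factors.\<close>

lemma ideal_augm: "ideal {p :: ('v, 'k::field) falg. augm p = 0} FA"
proof -
  have "0 \<in> Poly_Mapping.keys x \<and> 0 \<in> Poly_Mapping.keys y"
    if 0: "0 \<in> Poly_Mapping.keys (x * y)" for x y :: "('v, 'k) falg"
  proof -
    obtain u v where "0 = u + v" "u \<in> Poly_Mapping.keys x" "v \<in> Poly_Mapping.keys y"
      using keys_mult[of x y] 0 by blast
    then show ?thesis using mon_add_eq_0_iff[of u v] by auto
  qed
  then have "augm (x * y) = 0" if "augm x = 0 \<or> augm y = 0" for x y :: "('v, 'k) falg"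
    using that by (metis augm_eq_lookup in_keys_iff)
  then show ?thesis
    unfolding ideal_FA_iff by (simp add: augm_eq_lookup[of "_ + _"] augm_eq_lookup[of 0] lookup_add)
      (simp add: augm_eq_lookup)
qed

lemma Gam_proj_in_aug_ideal:
  assumes \<Omega>: "\<And>g. g \<in> \<Omega> \<Longrightarrow> augm g = 0" and p: "augm p = 0"
  shows "Gam_proj \<Omega> p \<in> aug_ideal \<Omega>"
proof -
  have "Idl\<^bsub>FA\<^esub> \<Omega> \<subseteq> {p. augm p = 0}"
    by (rule Idl_minimal[OF ideal_augm]) (use \<Omega> in auto)
  then have "augm ` Gam_proj \<Omega> p = {0}"
    using p ideal_0[OF ideal_Idl[of \<Omega>]]
    by (force simp: Gam_proj_def coset_FA augm_eq_lookup lookup_add image_iff)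
  then show ?thesis by (simp add: aug_ideal_def carrier_Gam Gam_augm_def)
qed

lemma vec_proj_in_aug_ideal_span:
  assumes \<Omega>: "\<And>g. g \<in> \<Omega> \<Longrightarrow> augm g = 0" and p: "\<And>i. i < t \<Longrightarrow> augm (p i) = 0"
  shows "vec_proj \<Omega> t p \<in> lin_combs (free_mod (Gam \<Omega>) t) (aug_ideal \<Omega>) (carrier (free_mod (Gam \<Omega>) t))"
proof -
  let ?F = "free_mod (Gam \<Omega>) t"
  have "(\<Oplus>\<^bsub>?F\<^esub> i\<in>{..<t}. Gam_proj \<Omega> (p i) \<odot>\<^bsub>?F\<^esub> basis_vec (Gam \<Omega>) t i) =
      vec_proj \<Omega> t (\<lambda>l. \<Sum>i<t. p i * (if l = i then 1 else 0))"
    by (rule finsum_vec_proj) (simp only: basis_vec_Gam vec_proj_smult)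
  also have "\<dots> = vec_proj \<Omega> t p"
    by (rule vec_proj_cong) (simp add: if_distrib cong: if_cong)
  finally have eq: "vec_proj \<Omega> t p =
      (\<Oplus>\<^bsub>?F\<^esub> i\<in>{..<t}. Gam_proj \<Omega> (p i) \<odot>\<^bsub>?F\<^esub> basis_vec (Gam \<Omega>) t i)" ..
  show ?thesis
    unfolding lin_combs_def
  proof (rule CollectI, intro exI conjI)
    show "(\<lambda>i. Gam_proj \<Omega> (p i)) \<in> {..<t} \<rightarrow> aug_ideal \<Omega>"
      by (rule Pi_I, rule Gam_proj_in_aug_ideal) (use \<Omega> p in auto)
    show "basis_vec (Gam \<Omega>) t \<in> {..<t} \<rightarrow> carrier ?F"
      by (rule Pi_I) (simp only: carrier_free_mod_Gam basis_vec_Gam rangeI)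
  qed (rule eq)
qed

section \<open>Exactness and minimality\<close>

lemma homog_lin_comb:
  assumes "c \<in> free_homog (homog a) r b' q" and "\<And>i. i < r \<Longrightarrow> h i \<in> free_homog (homog a) t b (b' i)"
    and "l < t"
  shows "(\<Sum>i<r. c i * h i l) \<in> homog a (q - b l)"
proof (rule homog_sum)
  fix i assume "i \<in> {..<r}"
  then have "c i \<in> homog a (q - b' i)" "h i l \<in> homog a (b' i - b l)"
    using assms by (auto simp: free_homog_def)
  from homog_mult[OF this] show "c i * h i l \<in> homog a (q - b l)" by simp
qed

text \<open>Taking the component of degree \<open>q\<close> of a representation of \<open>p\<close> makes the coefficients
  homogeneous and, as \<open>q \<le> k\<close>, moves the error term from the truncated ideal into the
  ideal of relations of \<open>\<Gamma>\<close>.\<close>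

lemma homog_trunc_gen_coeffs:
  fixes h :: "nat \<Rightarrow> nat \<Rightarrow> ('v, 'k::field) falg"
  assumes \<Omega>: "\<And>g. g \<in> \<Omega> \<Longrightarrow> \<exists>q. g \<in> homog a q"
    and h: "\<And>i. i < r \<Longrightarrow> h i \<in> free_homog (homog a) t b (b' i)"
    and p: "p \<in> free_homog (homog a) t b q" "p \<in> trunc_gen a \<Omega> k t b (h ` {..<r})" and "q \<le> k"
  obtains c where "c \<in> free_homog (homog a) r b' q"
    and "\<And>l. l < t \<Longrightarrow> p l - (\<Sum>i<r. c i * h i l) \<in> Idl\<^bsub>FA\<^esub> \<Omega>"
proof -
  obtain c where c: "\<And>l. l < t \<Longrightarrow> p l - (\<Sum>i<r. c i * h i l) \<in> trunc_ideal a \<Omega> (k - b l)"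
    using p(2) unfolding trunc_gen_iff[OF finite_lessThan] by blast
  \<comment> \<open>the part of the coefficient that lands in total degree \<open>q\<close>\<close>
  define c' where "c' = (\<lambda>i\<in>{..<r}. hcomp a (q - b' i) (c i))"
  have c': "c' \<in> free_homog (homog a) r b' q" by (auto simp: c'_def free_homog_def hcomp_homog)
  moreover have "p l - (\<Sum>i<r. c' i * h i l) \<in> Idl\<^bsub>FA\<^esub> \<Omega>" if l: "l < t" for l
  proof -
    let ?z = "p l - (\<Sum>i<r. c i * h i l)"
    have "hcomp a (q - b l) ?z \<in> Idl\<^bsub>FA\<^esub> \<Omega>"
      using c[OF l] trunc_ideal_iff[OF \<Omega>] \<open>q \<le> k\<close> by simp
    moreover have "hcomp a (q - b l) (\<Sum>i<r. c i * h i l) = (\<Sum>i<r. c' i * h i l)"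
      unfolding hcomp_sum
    proof (rule sum.cong[OF refl])
      fix i assume i: "i \<in> {..<r}"
      then have "h i l \<in> homog a (b' i - b l)" using h l by (auto simp: free_homog_def)
      from hcomp_mult_homog[OF this] show "hcomp a (q - b l) (c i * h i l) = c' i * h i l"
        using i by (simp add: c'_def)
    qed
    moreover have "p l \<in> homog a (q - b l)" using p(1) l by (auto simp: free_homog_def)
    then have "hcomp a (q - b l) (p l) = p l" by (simp add: hcomp_of_homog)
    moreover have "hcomp a (q - b l) ?z =
        hcomp a (q - b l) (p l) - hcomp a (q - b l) (\<Sum>i<r. c i * h i l)"
      by (simp add: eq_diff_eq flip: hcomp_add)
    ultimately show ?thesis by simp
  qed
  ultimately show thesis by (rule that)
qed

text \<open>In the application \<open>g\<close> is a homogeneous lift of the given differential. The lifts \<open>f\<close> and \<open>g\<close> differ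
  by elements that are only known to vanish in the truncated quotients. For rows of degree at most
  \<open>k\<close> this is already vanishing in \<open>\<Gamma>\<close>, and in rows of larger degree a homogeneous \<open>p\<close> of degree
  \<open>q \<le> k\<close> has coefficient \<open>0\<close>.\<close>

lemma homog_ker_iff_trunc_syz:
  fixes f g :: "nat \<Rightarrow> nat \<Rightarrow> ('v, 'k::field) falg"
  assumes \<Omega>: "\<And>g. g \<in> \<Omega> \<Longrightarrow> \<exists>q. g \<in> homog a q"
    and f: "\<And>i. i < t \<Longrightarrow> f i \<in> free_homog (homog a) s b (b' i)"
    and g: "\<And>i. i < t \<Longrightarrow> g i \<in> free_homog (homog a) s b (b' i)"
    and fg: "\<And>i j. i < t \<Longrightarrow> j < s \<Longrightarrow> f i j - g i j \<in> trunc_ideal a \<Omega> (k - b j)"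
    and p: "p \<in> free_homog (homog a) t b' q" and "q \<le> k"
  shows "(\<forall>j<s. (\<Sum>i<t. p i * g i j) \<in> Idl\<^bsub>FA\<^esub> \<Omega>) \<longleftrightarrow> p \<in> trunc_syz a \<Omega> k s b t f"
proof -
  have "(\<Sum>i<t. p i * g i j) \<in> Idl\<^bsub>FA\<^esub> \<Omega> \<longleftrightarrow>
      (\<Sum>i<t. p i * f i j) \<in> trunc_ideal a \<Omega> (k - b j)" if j: "j < s" for j
  proof -
    have "p i * (f i j - g i j) \<in> Idl\<^bsub>FA\<^esub> \<Omega>" if i: "i < t" for i
    proof (cases "b' i \<le> k")
      case True
      have "f i j - g i j \<in> homog a (b' i - b j)"
        using f[OF i] g[OF i] j by (auto simp: free_homog_def intro: homog_diff)
      from homog_trunc_ideal_iff[OF \<Omega> this] fg[OF i j] True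
      show ?thesis by (auto intro: ideal_lmult[OF ideal_Idl])
    next
      case False
      moreover have "p i \<in> homog a (q - b' i)" using p i by (auto simp: free_homog_def)
      ultimately have "p i = 0" using homog_negative \<open>q \<le> k\<close> by fastforce
      then show ?thesis by (simp add: ideal_0[OF ideal_Idl])
    qed
    then have "(\<Sum>i<t. p i * (f i j - g i j)) \<in> Idl\<^bsub>FA\<^esub> \<Omega>"
      by (intro ideal_sum[OF ideal_Idl]) simp
    then have diff: "(\<Sum>i<t. p i * f i j) - (\<Sum>i<t. p i * g i j) \<in> Idl\<^bsub>FA\<^esub> \<Omega>"
      by (simp add: right_diff_distrib sum_subtractf)
    have "(\<Sum>i<t. p i * g i j) \<in> Idl\<^bsub>FA\<^esub> \<Omega> \<longleftrightarrow> (\<Sum>i<t. p i * f i j) \<in> Idl\<^bsub>FA\<^esub> \<Omega>"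
      using ideal_diff[OF ideal_Idl _ diff] ideal_add[OF ideal_Idl diff] by fastforce
    also have "\<dots> \<longleftrightarrow> (\<Sum>i<t. p i * f i j) \<in> trunc_ideal a \<Omega> (k - b j)"
      using homog_trunc_ideal_iff[OF \<Omega> homog_lin_comb[OF p f j]] \<open>q \<le> k\<close> by simp
    finally show ?thesis .
  qed
  then show ?thesis using p by (auto simp: trunc_syz_iff free_homog_def PiE_iff)
qed

text \<open>Positivity of the degrees leaves the empty word as the only word of degree \<open>0\<close>.\<close>

lemma homog_unit_coeff:
  assumes a_pos: "\<And>i. a i > 0" and p: "p \<in> homog a q" and "augm p \<noteq> 0"
  shows "p = Poly_Mapping.single 0 (augm p)"
proof (rule poly_mapping_eqI)
  fix w :: "'a mon"
  have "q = 0"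
    using p \<open>augm p \<noteq> 0\<close> by (auto simp: homog_iff augm_eq_lookup mon_degree_def zero_mon_def)
  moreover have "mon_degree a w \<noteq> 0" if "w \<noteq> 0"
    using that a_pos by (cases w; cases "letters w") (auto simp: mon_degree_def zero_mon_def)
  ultimately show "Poly_Mapping.lookup p w = Poly_Mapping.lookup (Poly_Mapping.single 0 (augm p)) w"
    using p by (cases "w = 0") (auto simp: homog_iff augm_eq_lookup lookup_single)
qed

text \<open>A homogeneous coefficient with nonzero augmentation is a nonzero scalar, so the syzygy
  could be solved for the generator \<open>f l\<close>, against minimality.\<close>

lemma syz_of_minimal_augm:
  fixes f :: "nat \<Rightarrow> nat \<Rightarrow> ('v, 'k::field) falg"
  assumes a_pos: "\<And>i. a i > 0"
    and f: "f l \<in> extensional {..<s}" "f l \<notin> trunc_gen a \<Omega> k s b (f ` ({..<t} - {l}))"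
    and p: "p \<in> trunc_syz a \<Omega> k s b t f" and pl: "p l \<in> homog a q" and l: "l < t"
  shows "augm (p l) = 0"
proof (rule ccontr)
  assume c: "augm (p l) \<noteq> 0"
  define e where "e = Poly_Mapping.single (0 :: 'v mon) (inverse (augm (p l)))"
  have e: "e * p l = 1"
    using c by (subst homog_unit_coeff[OF a_pos pl c]) (simp add: e_def mult_single)
  have "f l j - (\<Sum>i\<in>{..<t} - {l}. - (e * p i) * f i j) \<in> trunc_ideal a \<Omega> (k - b j)" if "j < s" for j
  proof -
    have "(\<Sum>i<t. p i * f i j) \<in> trunc_ideal a \<Omega> (k - b j)"
      using p \<open>j < s\<close> by (simp add: trunc_syz_iff)
    then have "e * (\<Sum>i<t. p i * f i j) \<in> trunc_ideal a \<Omega> (k - b j)"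
      by (rule ideal_lmult[OF ideal_Idl])
    also have "e * (\<Sum>i<t. p i * f i j) = (\<Sum>i<t. e * p i * f i j)"
      by (simp add: sum_distrib_left mult.assoc)
    also have "\<dots> = f l j + (\<Sum>i\<in>{..<t} - {l}. e * p i * f i j)"
      using l by (simp add: sum.remove[of _ l] e)
    finally show ?thesis by (simp add: sum_negf)
  qed
  then have "f l \<in> trunc_gen a \<Omega> k s b (f ` ({..<t} - {l}))"
    using f(1) by (subst trunc_gen_iff) (auto intro!: exI[of _ "\<lambda>i. - (e * p i)"])
  with f(2) show False ..
qed

theorem mainTheorem1:
  fixes a :: "'v::countable \<Rightarrow> nat"
    and ord :: "('v mon \<times> 'v mon) set"
    and \<Omega> :: "('v, 'k::field) falg set"
    and k :: int
    and s t r :: nat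
    and deg_e deg_e' deg_e'' :: "nat \<Rightarrow> int"
    and d :: "(nat \<Rightarrow> ('v, 'k) falg set) \<Rightarrow> (nat \<Rightarrow> ('v, 'k) falg set)"
    and f h :: "nat \<Rightarrow> nat \<Rightarrow> ('v, 'k) falg"
  assumes a_pos: "\<And>i. a i > 0"
    and ord: "monomial_ordering ord"
    and Omega_homog: "\<And>g. g \<in> \<Omega> \<Longrightarrow> g \<noteq> 0 \<and> (\<exists>q. g \<in> homog a q)"
    and Omega_groebner: "groebner_basis ord \<Omega>"
    and Omega_augm: "\<And>g. g \<in> \<Omega> \<Longrightarrow> augm g = 0"
    and k_pos: "k > 0"
    and d_hom: "d \<in> left_module_hom (Gam \<Omega>) (free_mod (Gam \<Omega>) t) (free_mod (Gam \<Omega>) s)"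
    and d_degree: "\<And>q x. x \<in> free_homog (Gam_homog a \<Omega>) t deg_e' q \<Longrightarrow>
                     d x \<in> free_homog (Gam_homog a \<Omega>) s deg_e q"
    and f_homog: "\<And>i. i < t \<Longrightarrow> f i \<in> free_homog (homog a) s deg_e (deg_e' i)"
    and f_lifts_d: "\<And>i j. i < t \<Longrightarrow> j < s \<Longrightarrow>
                      trunc_ideal a \<Omega> (k - deg_e j) +>\<^bsub>FA\<^esub> f i j =
                      trunc_ideal a \<Omega> (k - deg_e j) <+>\<^bsub>FA\<^esub> d (basis_vec (Gam \<Omega>) t i) j"
    and f_min: "trunc_min_gen a \<Omega> k s deg_e t f (trunc_gen a \<Omega> k s deg_e (f ` {..<t}))"
    and h_homog: "\<And>i. i < r \<Longrightarrow> h i \<in> free_homog (homog a) t deg_e' (deg_e'' i)"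
    and h_min: "trunc_min_gen a \<Omega> k t deg_e' r h (trunc_syz a \<Omega> k s deg_e t f)"
  shows "let F = free_mod (Gam \<Omega>) t;
             d' = free_map F r (\<lambda>i. \<lambda>l\<in>{..<t}. Gam_proj \<Omega> (h i l))
         in (\<forall>q \<le> k. d' ` free_homog (Gam_homog a \<Omega>) r deg_e'' q =
                {x \<in> free_homog (Gam_homog a \<Omega>) t deg_e' q. d x = \<zero>\<^bsub>free_mod (Gam \<Omega>) s\<^esub>})
          \<and> d' ` carrier (free_mod (Gam \<Omega>) r) \<subseteq> lin_combs F (aug_ideal \<Omega>) (carrier F)"
proof -
  have \<Omega>: "\<exists>q. g \<in> homog a q" if "g \<in> \<Omega>" for g using Omega_homog[OF that] ..
  let ?I = "Idl\<^bsub>FA\<^esub> \<Omega>" and ?F = "free_mod (Gam \<Omega>) t"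
  define d' where "d' = free_map ?F r (\<lambda>i. vec_proj \<Omega> t (h i))"
  have d': "d' (vec_proj \<Omega> r c) = vec_proj \<Omega> t (\<lambda>l. \<Sum>i<r. c i * h i l)" for c
    by (simp add: d'_def free_map_Gam)

  \<comment> \<open>basis vectors are homogeneous, so \<open>d\<close> has a homogeneous matrix over the free algebra\<close>
  have "\<forall>i. \<exists>g. i < t \<longrightarrow> g \<in> free_homog (homog a) s deg_e (deg_e' i) \<and>
      d (basis_vec (Gam \<Omega>) t i) = vec_proj \<Omega> s g"
  proof
    fix i
    have "(\<lambda>j\<in>{..<t}. if j = i then 1 else 0) \<in> free_homog (homog a) t deg_e' (deg_e' i)"
      by (auto simp: free_homog_def homog_1)
    moreover have "basis_vec (Gam \<Omega>) t i = vec_proj \<Omega> t (\<lambda>j\<in>{..<t}. if j = i then 1 else 0)"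
      unfolding basis_vec_Gam by (rule vec_proj_cong) simp
    ultimately have "basis_vec (Gam \<Omega>) t i \<in> free_homog (Gam_homog a \<Omega>) t deg_e' (deg_e' i)"
      unfolding free_homog_Gam by (metis imageI)
    from d_degree[OF this] show "\<exists>g. i < t \<longrightarrow> g \<in> free_homog (homog a) s deg_e (deg_e' i) \<and>
        d (basis_vec (Gam \<Omega>) t i) = vec_proj \<Omega> s g"
      unfolding free_homog_Gam by blast
  qed
  then obtain g where g: "\<And>i. i < t \<Longrightarrow> g i \<in> free_homog (homog a) s deg_e (deg_e' i)"
    and dg: "\<And>i. i < t \<Longrightarrow> d (basis_vec (Gam \<Omega>) t i) = vec_proj \<Omega> s (g i)" by metis
  have fg: "f i j - g i j \<in> trunc_ideal a \<Omega> (k - deg_e j)" if "i < t" "j < s" for i j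
  proof -
    have "d (basis_vec (Gam \<Omega>) t i) j = Gam_proj \<Omega> (g i j)"
      using that by (simp add: dg vec_proj_def)
    then show ?thesis
      using f_lifts_d[OF that] unfolding coset_eq_iff[OF ideal_Idl, symmetric]
      by (simp add: set_add_Gam_proj[OF ideal_Idl Idl_subset_trunc_ideal])
  qed
  have d_vec_proj: "d (vec_proj \<Omega> t p) = vec_proj \<Omega> s (\<lambda>j. \<Sum>i<t. p i * g i j)" for p
    using d_hom dg by (rule left_module_hom_vec_proj)
  have ker: "d (vec_proj \<Omega> t p) = \<zero>\<^bsub>free_mod (Gam \<Omega>) s\<^esub> \<longleftrightarrow> p \<in> trunc_syz a \<Omega> k s deg_e t f"
    if "p \<in> free_homog (homog a) t deg_e' q" "q \<le> k" for p q
  proof -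
    have "d (vec_proj \<Omega> t p) = \<zero>\<^bsub>free_mod (Gam \<Omega>) s\<^esub> \<longleftrightarrow> (\<forall>j<s. (\<Sum>i<t. p i * g i j) \<in> ?I)"
      by (simp add: d_vec_proj vec_proj_zero vec_proj_eq_iff del: free_mod_simps)
    then show ?thesis
      using homog_ker_iff_trunc_syz[OF \<Omega> f_homog g fg that] by blast
  qed
  have syz: "trunc_syz a \<Omega> k s deg_e t f = trunc_gen a \<Omega> k t deg_e' (h ` {..<r})"
    using h_min by (simp add: trunc_min_gen_def)
  have lin_comb_syz: "(\<lambda>l\<in>{..<t}. \<Sum>i<r. c i * h i l) \<in> trunc_syz a \<Omega> k s deg_e t f" for c
    unfolding syz trunc_gen_iff[OF finite_lessThan]
    by (auto intro!: exI[of _ c] ideal_0[OF ideal_Idl])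

  have exact: "d' ` free_homog (Gam_homog a \<Omega>) r deg_e'' q =
      {x \<in> free_homog (Gam_homog a \<Omega>) t deg_e' q. d x = \<zero>\<^bsub>free_mod (Gam \<Omega>) s\<^esub>}" if "q \<le> k" for q
  proof (rule equalityI; rule subsetI)
    fix x assume "x \<in> d' ` free_homog (Gam_homog a \<Omega>) r deg_e'' q"
    then obtain c where c: "c \<in> free_homog (homog a) r deg_e'' q" and x: "x = d' (vec_proj \<Omega> r c)"
      unfolding free_homog_Gam by blast
    let ?p = "\<lambda>l\<in>{..<t}. \<Sum>i<r. c i * h i l"
    have "x = vec_proj \<Omega> t ?p" unfolding x d' by (rule vec_proj_cong) simp
    moreover have "?p \<in> free_homog (homog a) t deg_e' q"
      using homog_lin_comb[OF c h_homog] by (auto simp: free_homog_def)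
    ultimately show "x \<in> {x \<in> free_homog (Gam_homog a \<Omega>) t deg_e' q. d x = \<zero>\<^bsub>free_mod (Gam \<Omega>) s\<^esub>}"
      using ker[OF _ that] lin_comb_syz unfolding free_homog_Gam by blast
  next
    fix x assume x: "x \<in> {x \<in> free_homog (Gam_homog a \<Omega>) t deg_e' q. d x = \<zero>\<^bsub>free_mod (Gam \<Omega>) s\<^esub>}"
    then obtain p where p: "p \<in> free_homog (homog a) t deg_e' q" and xp: "x = vec_proj \<Omega> t p"
      unfolding free_homog_Gam by blast
    then have "p \<in> trunc_gen a \<Omega> k t deg_e' (h ` {..<r})" using x ker[OF p that] syz by blast
    from homog_trunc_gen_coeffs[OF \<Omega> h_homog p this that]
    obtain c where c: "c \<in> free_homog (homog a) r deg_e'' q"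
      and "\<And>l. l < t \<Longrightarrow> p l - (\<Sum>i<r. c i * h i l) \<in> ?I" by blast
    then have "x = d' (vec_proj \<Omega> r c)" unfolding xp d' vec_proj_eq_iff by blast
    then show "x \<in> d' ` free_homog (Gam_homog a \<Omega>) r deg_e'' q"
      using c unfolding free_homog_Gam by blast
  qed

  have augm_h: "augm (h i l) = 0" if "i < r" "l < t" for i l
  proof (rule syz_of_minimal_augm[OF a_pos])
    have h_eq: "h i = (\<lambda>l\<in>{..<t}. \<Sum>n<r. (if n = i then 1 else 0) * h n l)"
      using h_homog[OF \<open>i < r\<close>] \<open>i < r\<close>
      by (auto simp: free_homog_def PiE_iff extensional_def fun_eq_iff if_distrib[of "\<lambda>x. x * _"] cong: if_cong)
    show "h i \<in> trunc_syz a \<Omega> k s deg_e t f" by (subst h_eq) (rule lin_comb_syz)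
    show "f l \<in> extensional {..<s}" using f_homog[OF \<open>l < t\<close>] by (auto simp: free_homog_def PiE_iff)
    show "f l \<notin> trunc_gen a \<Omega> k s deg_e (f ` ({..<t} - {l}))"
      using f_min \<open>l < t\<close> by (simp add: trunc_min_gen_def)
    show "h i l \<in> homog a (deg_e'' i - deg_e' l)"
      using h_homog[OF \<open>i < r\<close>] \<open>l < t\<close> by (auto simp: free_homog_def)
  qed fact
  have "d' x \<in> lin_combs ?F (aug_ideal \<Omega>) (carrier ?F)"
    if x_in: "x \<in> carrier (free_mod (Gam \<Omega>) r)" for x
  proof -
    obtain c where x: "x = vec_proj \<Omega> r c" using x_in unfolding carrier_free_mod_Gam by blast
    have "(\<Sum>i<r. c i * h i l) \<in> {p. augm p = 0}" if "l < t" for l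
      by (intro ideal_sum[OF ideal_augm] ideal_lmult[OF ideal_augm]) (simp add: augm_h that)
    then show ?thesis unfolding x d' by (intro vec_proj_in_aug_ideal_span[OF Omega_augm]) auto
  qed
  with exact show ?thesis
    unfolding Let_def d'_def vec_proj_def by blast
qed

end
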